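(* Let $\mathbb{C}$ be a regular category. Then: (1) any arrow $f \colon A \to B$ in $\mathbb{C}$ has a factorization $f = m \circ q$ with $q \colon A \to I$ a regular epimorphism and $m \colon I \to B$ a monomorphism; (2) this factorization is unique up to isomorphism: if $f = m \circ q = m' \circ q'$ with $q \colon A \to I$, $q' \colon A \to I'$ regular epimorphisms and $m \colon I \to B$, $m' \colon I' \to B$ monomorphisms, then there is an isomorphism $\theta \colon I \to I'$ such that $\theta \circ q = q'$ and $m' \circ \theta = m$.
   Context: A regular epimorphism is an arrow that is the coequalizer of some pair of parallel arrows. The kernel pair $(\mathsf{Eq}(f), p_1, p_2)$ of an arrow $f \colon A \to B$ is the pullback of $f$ along itself. A finitely complete category $\mathbb{C}$ is regular if (i) every kernel pair has a coequalizer in $\mathbb{C}$, and (ii) regular epimorphisms are stable under pullback in $\mathbb{C}$. *)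

theory Defs
  imports Main
begin

text \<open>Only the values of \<open>Dom\<close>, \<open>Cod\<close> and \<open>Id\<close> on the carriers \<open>Arr\<close> and \<open>Obj\<close>, and of the
  composition on composable pairs of arrows, are meaningful. Composition is written in the
  classical order: \<open>g \<cdot>\<^bsub>C\<^esub> f\<close> is ``\<open>g\<close> after \<open>f\<close>''.\<close>

record ('o, 'a) cat =
  Obj :: "'o set"
  Arr :: "'a set"
  Dom :: "'a \<Rightarrow> 'o"
  Cod :: "'a \<Rightarrow> 'o"
  Id :: "'o \<Rightarrow> 'a"
  Comp :: "'a \<Rightarrow> 'a \<Rightarrow> 'a"  (infixl "\<cdot>\<index>" 70)

definition Hom :: "('o, 'a) cat \<Rightarrow> 'o \<Rightarrow> 'o \<Rightarrow> 'a set" where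
  "Hom C A B = {f \<in> Arr C. Dom C f = A \<and> Cod C f = B}"

locale category =
  fixes C :: "('o, 'a) cat" (structure)
  assumes Dom_in_Obj: "f \<in> Arr C \<Longrightarrow> Dom C f \<in> Obj C"
    and Cod_in_Obj: "f \<in> Arr C \<Longrightarrow> Cod C f \<in> Obj C"
    and Id_in_Hom: "A \<in> Obj C \<Longrightarrow> Id C A \<in> Hom C A A"
    and Comp_in_Hom: "f \<in> Hom C A B \<Longrightarrow> g \<in> Hom C B D \<Longrightarrow> g \<cdot> f \<in> Hom C A D"
    and Comp_Id: "f \<in> Hom C A B \<Longrightarrow> f \<cdot> Id C A = f"
    and Id_Comp: "f \<in> Hom C A B \<Longrightarrow> Id C B \<cdot> f = f"
    and Comp_assoc: "f \<in> Hom C A B \<Longrightarrow> g \<in> Hom C B D \<Longrightarrow> h \<in> Hom C D E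
                      \<Longrightarrow> (h \<cdot> g) \<cdot> f = h \<cdot> (g \<cdot> f)"

locale cat_functor = J: category J + C: category C
  for J :: "('j, 'k) cat" and C :: "('o, 'a) cat" +
  fixes Fo :: "'j \<Rightarrow> 'o" and Fa :: "'k \<Rightarrow> 'a"
  assumes Fo_in_Obj: "j \<in> Obj J \<Longrightarrow> Fo j \<in> Obj C"
    and Fa_in_Hom: "u \<in> Hom J i j \<Longrightarrow> Fa u \<in> Hom C (Fo i) (Fo j)"
    and Fa_Id: "j \<in> Obj J \<Longrightarrow> Fa (Id J j) = Id C (Fo j)"
    and Fa_Comp: "u \<in> Hom J i j \<Longrightarrow> v \<in> Hom J j k \<Longrightarrow> Fa (v \<cdot>\<^bsub>J\<^esub> u) = Fa v \<cdot>\<^bsub>C\<^esub> Fa u"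

definition is_cone ::
  "('j, 'k) cat \<Rightarrow> ('o, 'a) cat \<Rightarrow> ('j \<Rightarrow> 'o) \<Rightarrow> ('k \<Rightarrow> 'a) \<Rightarrow> 'o \<Rightarrow> ('j \<Rightarrow> 'a) \<Rightarrow> bool" where
  "is_cone J C Fo Fa L p \<longleftrightarrow>
     L \<in> Obj C \<and> (\<forall>j\<in>Obj J. p j \<in> Hom C L (Fo j)) \<and>
     (\<forall>u\<in>Arr J. Fa u \<cdot>\<^bsub>C\<^esub> p (Dom J u) = p (Cod J u))"

definition is_limit ::
  "('j, 'k) cat \<Rightarrow> ('o, 'a) cat \<Rightarrow> ('j \<Rightarrow> 'o) \<Rightarrow> ('k \<Rightarrow> 'a) \<Rightarrow> 'o \<Rightarrow> ('j \<Rightarrow> 'a) \<Rightarrow> bool" where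
  "is_limit J C Fo Fa L p \<longleftrightarrow>
     is_cone J C Fo Fa L p \<and>
     (\<forall>X x. is_cone J C Fo Fa X x \<longrightarrow>
        (\<exists>!h. h \<in> Hom C X L \<and> (\<forall>j\<in>Obj J. p j \<cdot>\<^bsub>C\<^esub> h = x j)))"

text \<open>A definition cannot quantify over types; since every finite category is isomorphic to one
  whose objects and arrows are natural numbers, it suffices to let the shape of a finite diagram
  range over these.\<close>

definition finitely_complete :: "('o, 'a) cat \<Rightarrow> bool" where
  "finitely_complete C \<longleftrightarrow>
     (\<forall>(J :: (nat, nat) cat) Fo Fa.
        cat_functor J C Fo Fa \<and> finite (Obj J) \<and> finite (Arr J) \<longrightarrow>
        (\<exists>L p. is_limit J C Fo Fa L p))"

definition monomorphism :: "('o, 'a) cat \<Rightarrow> 'a \<Rightarrow> bool" where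
  "monomorphism C m \<longleftrightarrow>
     m \<in> Arr C \<and>
     (\<forall>X. \<forall>g\<in>Hom C X (Dom C m). \<forall>h\<in>Hom C X (Dom C m). m \<cdot>\<^bsub>C\<^esub> g = m \<cdot>\<^bsub>C\<^esub> h \<longrightarrow> g = h)"

definition isomorphism :: "('o, 'a) cat \<Rightarrow> 'a \<Rightarrow> bool" where
  "isomorphism C f \<longleftrightarrow>
     f \<in> Arr C \<and>
     (\<exists>g\<in>Hom C (Cod C f) (Dom C f).
        g \<cdot>\<^bsub>C\<^esub> f = Id C (Dom C f) \<and> f \<cdot>\<^bsub>C\<^esub> g = Id C (Cod C f))"

definition is_pullback ::
  "('o, 'a) cat \<Rightarrow> 'a \<Rightarrow> 'a \<Rightarrow> 'o \<Rightarrow> 'a \<Rightarrow> 'a \<Rightarrow> bool" where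
  "is_pullback C f g P p1 p2 \<longleftrightarrow>
     f \<in> Arr C \<and> g \<in> Arr C \<and> Cod C f = Cod C g \<and>
     p1 \<in> Hom C P (Dom C f) \<and> p2 \<in> Hom C P (Dom C g) \<and> f \<cdot>\<^bsub>C\<^esub> p1 = g \<cdot>\<^bsub>C\<^esub> p2 \<and>
     (\<forall>X. \<forall>x1\<in>Hom C X (Dom C f). \<forall>x2\<in>Hom C X (Dom C g). f \<cdot>\<^bsub>C\<^esub> x1 = g \<cdot>\<^bsub>C\<^esub> x2 \<longrightarrow>
        (\<exists>!h. h \<in> Hom C X P \<and> p1 \<cdot>\<^bsub>C\<^esub> h = x1 \<and> p2 \<cdot>\<^bsub>C\<^esub> h = x2))"

definition is_kernel_pair :: "('o, 'a) cat \<Rightarrow> 'a \<Rightarrow> 'o \<Rightarrow> 'a \<Rightarrow> 'a \<Rightarrow> bool" where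
  "is_kernel_pair C f P p1 p2 \<longleftrightarrow> is_pullback C f f P p1 p2"

definition is_coequalizer :: "('o, 'a) cat \<Rightarrow> 'a \<Rightarrow> 'a \<Rightarrow> 'a \<Rightarrow> bool" where
  "is_coequalizer C u v q \<longleftrightarrow>
     u \<in> Arr C \<and> v \<in> Arr C \<and> Dom C u = Dom C v \<and> Cod C u = Cod C v \<and>
     q \<in> Arr C \<and> Dom C q = Cod C u \<and> q \<cdot>\<^bsub>C\<^esub> u = q \<cdot>\<^bsub>C\<^esub> v \<and>
     (\<forall>X. \<forall>x\<in>Hom C (Cod C u) X. x \<cdot>\<^bsub>C\<^esub> u = x \<cdot>\<^bsub>C\<^esub> v \<longrightarrow>
        (\<exists>!h. h \<in> Hom C (Cod C q) X \<and> h \<cdot>\<^bsub>C\<^esub> q = x))"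

definition regular_epi :: "('o, 'a) cat \<Rightarrow> 'a \<Rightarrow> bool" where
  "regular_epi C q \<longleftrightarrow> (\<exists>u v. is_coequalizer C u v q)"

locale regular_category = category C for C :: "('o, 'a) cat" (structure) +
  assumes finitely_complete: "finitely_complete C"
    and kernel_pair_has_coequalizer:
      "is_kernel_pair C f P p1 p2 \<Longrightarrow> \<exists>q. is_coequalizer C p1 p2 q"
    and regular_epi_pullback_stable:
      "regular_epi C f \<Longrightarrow> is_pullback C f g P p1 p2 \<Longrightarrow> regular_epi C p2"

end

theory Submission
  imports Defs
begin

text \<open>The arrow \<open>q\<close> is the coequalizer of the kernel pair of \<open>f\<close>, and \<open>m\<close> is the induced arrow. To see
  that \<open>m\<close> is monic, let \<open>m \<cdot> g = m \<cdot> h\<close>. Pulling back \<open>q\<close> along \<open>g\<close> and \<open>h\<close> covers the common domain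
  of \<open>g\<close> and \<open>h\<close> by a composite of regular epimorphisms, on which \<open>g\<close> and \<open>h\<close> lift to a pair of
  arrows into \<open>A\<close> identified by \<open>f\<close>. This pair factors through the kernel pair, so \<open>q\<close> identifies
  it. Uniqueness holds because regular epimorphisms are orthogonal to monomorphisms.\<close>

lemma HomD:
  assumes "f \<in> Hom C A B"
  shows "f \<in> Arr C" "Dom C f = A" "Cod C f = B"
  using assms by (auto simp: Hom_def)

lemma monomorphismD:
  assumes "monomorphism C m" "m \<in> Hom C A B" "g \<in> Hom C X A" "h \<in> Hom C X A"
    and "m \<cdot>\<^bsub>C\<^esub> g = m \<cdot>\<^bsub>C\<^esub> h"
  shows "g = h"
  using assms by (auto simp: monomorphism_def Hom_def)

lemma coequalizerD:
  assumes "is_coequalizer C u v q" "q \<in> Hom C A I"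
  shows "u \<in> Hom C (Dom C u) A" "v \<in> Hom C (Dom C u) A" "q \<cdot>\<^bsub>C\<^esub> u = q \<cdot>\<^bsub>C\<^esub> v"
    "x \<in> Hom C A X \<Longrightarrow> x \<cdot>\<^bsub>C\<^esub> u = x \<cdot>\<^bsub>C\<^esub> v \<Longrightarrow> \<exists>!h. h \<in> Hom C I X \<and> h \<cdot>\<^bsub>C\<^esub> q = x"
proof -
  have coeq: "Dom C u = Dom C v" "Cod C u = A" "Cod C v = A" "u \<in> Arr C" "v \<in> Arr C"
    using assms by (simp_all add: is_coequalizer_def Hom_def)
  then show "u \<in> Hom C (Dom C u) A" "v \<in> Hom C (Dom C u) A"
    by (simp_all add: Hom_def)
  show "q \<cdot>\<^bsub>C\<^esub> u = q \<cdot>\<^bsub>C\<^esub> v"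
    using assms(1) by (simp add: is_coequalizer_def)
  show "\<exists>!h. h \<in> Hom C I X \<and> h \<cdot>\<^bsub>C\<^esub> q = x" if "x \<in> Hom C A X" "x \<cdot>\<^bsub>C\<^esub> u = x \<cdot>\<^bsub>C\<^esub> v"
    using assms(1) that unfolding is_coequalizer_def HomD(3)[OF assms(2)] coeq(2) by blast
qed

lemma pullbackD:
  assumes "is_pullback C f g P p1 p2" "f \<in> Hom C A B" "g \<in> Hom C D E"
  shows "p1 \<in> Hom C P A" "p2 \<in> Hom C P D" "f \<cdot>\<^bsub>C\<^esub> p1 = g \<cdot>\<^bsub>C\<^esub> p2"
    "x \<in> Hom C X A \<Longrightarrow> y \<in> Hom C X D \<Longrightarrow> f \<cdot>\<^bsub>C\<^esub> x = g \<cdot>\<^bsub>C\<^esub> y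
      \<Longrightarrow> \<exists>k\<in>Hom C X P. p1 \<cdot>\<^bsub>C\<^esub> k = x \<and> p2 \<cdot>\<^bsub>C\<^esub> k = y"
proof -
  show "p1 \<in> Hom C P A" "p2 \<in> Hom C P D" "f \<cdot>\<^bsub>C\<^esub> p1 = g \<cdot>\<^bsub>C\<^esub> p2"
    using assms by (auto simp: is_pullback_def HomD)
  assume "x \<in> Hom C X A" "y \<in> Hom C X D" "f \<cdot>\<^bsub>C\<^esub> x = g \<cdot>\<^bsub>C\<^esub> y"
  then have "\<exists>!k. k \<in> Hom C X P \<and> p1 \<cdot>\<^bsub>C\<^esub> k = x \<and> p2 \<cdot>\<^bsub>C\<^esub> k = y"
    using assms unfolding is_pullback_def by (auto simp only: HomD)
  then show "\<exists>k\<in>Hom C X P. p1 \<cdot>\<^bsub>C\<^esub> k = x \<and> p2 \<cdot>\<^bsub>C\<^esub> k = y"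
    by blast
qed

text \<open>The objects of the shape \<open>0 \<rightarrow> 2 \<leftarrow> 1\<close> double as their identity arrows; \<open>3\<close> and \<open>4\<close> are the
  two remaining arrows.\<close>

definition cospan_shape :: "(nat, nat) cat" where
  "cospan_shape = \<lparr>Obj = {0, 1, 2}, Arr = {0, 1, 2, 3, 4},
     Dom = (\<lambda>u. if u = 3 then 0 else if u = 4 then 1 else u),
     Cod = (\<lambda>u. if u \<ge> 3 then 2 else u),
     Id = (\<lambda>j. j),
     Comp = (\<lambda>v u. if u \<le> 2 then v else u)\<rparr>"

text \<open>In a composable pair of the shape at least one arrow is an identity, that is, at most
  \<open>2\<close>; returning the other arrow therefore composes correctly.\<close>

lemma category_cospan_shape: "category cospan_shape"
  by unfold_locales (auto simp: cospan_shape_def Hom_def split: if_splits)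

context category
begin

text \<open>The arrow \<open>g \<cdot> q\<close> coequalizes the pair defining \<open>q\<close>, and
  \<open>g\<close> and \<open>h\<close> both factor it through \<open>q\<close>; the uniqueness half
  of the universal property identifies them.\<close>

lemma regular_epi_cancel:
  assumes "regular_epi C q" "q \<in> Hom C A I" "g \<in> Hom C I X" "h \<in> Hom C I X"
    and eq: "g \<cdot> q = h \<cdot> q"
  shows "g = h"
proof -
  obtain u v where uv: "is_coequalizer C u v q"
    using assms(1) by (auto simp: regular_epi_def)
  note c = coequalizerD[OF uv assms(2)]
  have "(g \<cdot> q) \<cdot> u = (g \<cdot> q) \<cdot> v"
    using Comp_assoc[OF c(1) assms(2,3)] Comp_assoc[OF c(2) assms(2,3)] c(3) by simp
  then show ?thesis
    using c(4)[OF Comp_in_Hom[OF assms(2,3)]] assms(3,4) eq by metis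
qed

text \<open>If \<open>q\<close> coequalizes \<open>u\<close> and \<open>v\<close>, then so does
  \<open>m \<cdot> q = n \<cdot> x\<close>. Since \<open>n\<close> is monic, already
  \<open>x\<close> coequalizes them and factors through \<open>q\<close>, which gives the diagonal.
  The second triangle commutes after precomposition with \<open>q\<close>, and \<open>q\<close>
  cancels.\<close>

lemma regular_epi_mono_diagonal:
  assumes q: "regular_epi C q" "q \<in> Hom C A I" and m: "m \<in> Hom C I B"
    and x: "x \<in> Hom C A X" and n: "monomorphism C n" "n \<in> Hom C X B"
    and eq: "m \<cdot> q = n \<cdot> x"
  shows "\<exists>d\<in>Hom C I X. d \<cdot> q = x \<and> n \<cdot> d = m"
proof -
  obtain u v where uv: "is_coequalizer C u v q"
    using q(1) by (auto simp: regular_epi_def)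
  note c = coequalizerD[OF uv q(2)]
  have "(m \<cdot> q) \<cdot> u = (m \<cdot> q) \<cdot> v"
    using Comp_assoc[OF c(1) q(2) m] Comp_assoc[OF c(2) q(2) m] c(3) by simp
  then have "n \<cdot> (x \<cdot> u) = n \<cdot> (x \<cdot> v)"
    using Comp_assoc[OF c(1) x n(2)] Comp_assoc[OF c(2) x n(2)] eq by simp
  then have "x \<cdot> u = x \<cdot> v"
    using monomorphismD[OF n Comp_in_Hom[OF c(1) x] Comp_in_Hom[OF c(2) x]] by simp
  then obtain d where d: "d \<in> Hom C I X" "d \<cdot> q = x"
    using c(4)[OF x] by blast
  have "(n \<cdot> d) \<cdot> q = m \<cdot> q"
    using Comp_assoc[OF q(2) d(1) n(2)] d(2) eq by simp
  then have "n \<cdot> d = m"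
    using regular_epi_cancel[OF q Comp_in_Hom[OF d(1) n(2)] m] by simp
  with d show ?thesis by blast
qed

text \<open>This recognizes the round trips between two factorizations as identities.\<close>

lemma regular_epi_endo_eq_Id:
  assumes "regular_epi C q" "q \<in> Hom C A I" "t \<in> Hom C I I" "t \<cdot> q = q"
  shows "t = Id C I"
proof -
  have "I \<in> Obj C"
    using assms(2) Cod_in_Obj HomD by metis
  then show ?thesis
    using regular_epi_cancel[OF assms(1-3) Id_in_Hom] Id_Comp[OF assms(2)] assms(4) by simp
qed

text \<open>The square has a diagonal in each direction. Their composites fix \<open>q\<close> and
  \<open>q'\<close> respectively, so they are identities.\<close>

lemma regular_epi_mono_factorization_unique:
  assumes q: "regular_epi C q" "q \<in> Hom C A I" and m: "monomorphism C m" "m \<in> Hom C I B"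
    and q': "regular_epi C q'" "q' \<in> Hom C A I'" and m': "monomorphism C m'" "m' \<in> Hom C I' B"
    and eq: "m \<cdot> q = m' \<cdot> q'"
  shows "\<exists>\<theta>\<in>Hom C I I'. isomorphism C \<theta> \<and> \<theta> \<cdot> q = q' \<and> m' \<cdot> \<theta> = m"
proof -
  obtain s where s: "s \<in> Hom C I I'" "s \<cdot> q = q'" "m' \<cdot> s = m"
    using regular_epi_mono_diagonal[OF q m(2) q'(2) m' eq] by blast
  obtain t where t: "t \<in> Hom C I' I" "t \<cdot> q' = q"
    using regular_epi_mono_diagonal[OF q' m'(2) q(2) m eq[symmetric]] by blast
  have "(t \<cdot> s) \<cdot> q = q" "(s \<cdot> t) \<cdot> q' = q'"
    using Comp_assoc[OF q(2) s(1) t(1)] Comp_assoc[OF q'(2) t(1) s(1)] s(2) t(2) by simp_all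
  then have "t \<cdot> s = Id C I" "s \<cdot> t = Id C I'"
    using regular_epi_endo_eq_Id[OF q Comp_in_Hom[OF s(1) t(1)]]
      regular_epi_endo_eq_Id[OF q' Comp_in_Hom[OF t(1) s(1)]] by simp_all
  then have "isomorphism C s"
    using s(1) t(1) unfolding isomorphism_def by (auto simp: HomD[OF s(1)])
  with s show ?thesis by blast
qed

text \<open>A pullback is a limit over the cospan shape with its leg at the vertex \<open>2\<close>
  forgotten, since that leg is determined by the other two.\<close>

lemma pullback_exists:
  assumes "finitely_complete C" and f: "f \<in> Hom C A B" and g: "g \<in> Hom C D B"
  shows "\<exists>P p1 p2. is_pullback C f g P p1 p2"
proof -
  let ?J = cospan_shape
  define Fo where "Fo j = (if j = 0 then A else if j = 1 then D else B)" for j :: nat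
  define Fa where "Fa u = (if u = 3 then f else if u = 4 then g else Id C (Fo u))" for u :: nat
  have Obj: "A \<in> Obj C" "B \<in> Obj C" "D \<in> Obj C"
    using f g Dom_in_Obj Cod_in_Obj HomD by metis+
  note Id = Id_in_Hom[OF Obj(1)] Id_in_Hom[OF Obj(2)] Id_in_Hom[OF Obj(3)]
  interpret J: category ?J by (rule category_cospan_shape)
  have hom: "u \<in> Hom ?J i j \<longleftrightarrow>
      u = i \<and> i = j \<and> i \<in> {0, 1, 2} \<or> u = 3 \<and> i = 0 \<and> j = 2 \<or> u = 4 \<and> i = 1 \<and> j = 2" for u i j
    by (auto simp: cospan_shape_def Hom_def split: if_splits)
  have "cat_functor ?J C Fo Fa"
  proof unfold_locales
    show "Fo j \<in> Obj C" if "j \<in> Obj ?J" for j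
      using Obj by (simp add: Fo_def)
    show "Fa u \<in> Hom C (Fo i) (Fo j)" if "u \<in> Hom ?J i j" for u i j
      using that Id f g unfolding hom by (auto simp: Fo_def Fa_def)
    show "Fa (Id ?J j) = Id C (Fo j)" if "j \<in> Obj ?J" for j
      using that by (auto simp: cospan_shape_def Fa_def)
    \<comment> \<open>One factor is always an identity, so this reduces to the unit laws of
      \<open>C\<close>.\<close>
    show "Fa (v \<cdot>\<^bsub>?J\<^esub> u) = Fa v \<cdot> Fa u" if "u \<in> Hom ?J i j" "v \<in> Hom ?J j k" for u v i j k
      using that Id[THEN Id_Comp] f[THEN Id_Comp] g[THEN Id_Comp] f[THEN Comp_Id] g[THEN Comp_Id]
      unfolding hom by (auto simp: cospan_shape_def Fo_def Fa_def)
  qed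
  moreover have "finite (Obj ?J)" "finite (Arr ?J)"
    by (simp_all add: cospan_shape_def)
  ultimately obtain P p where lim: "is_limit ?J C Fo Fa P p"
    using assms(1) unfolding finitely_complete_def by blast
  \<comment> \<open>The arrows \<open>3\<close> and \<open>4\<close> force the leg at
    \<open>2\<close> to be both composites, while the identities impose nothing further: a cone is a
    commuting square on \<open>f\<close> and \<open>g\<close>.\<close>
  have cone: "is_cone ?J C Fo Fa X x \<longleftrightarrow>
      x 0 \<in> Hom C X A \<and> x 1 \<in> Hom C X D \<and> x 2 = f \<cdot> x 0 \<and> x 2 = g \<cdot> x 1" for X x
  proof -
    have "X \<in> Obj C" if "x 0 \<in> Hom C X A"
      using that Dom_in_Obj HomD by metis
    then show ?thesis
      using Comp_in_Hom[OF _ f, of "x 0" X] Id_Comp[of "x 0" X A] Id_Comp[of "x 1" X D]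
        Id_Comp[of "x 2" X B]
      by (auto simp: is_cone_def cospan_shape_def Fo_def Fa_def)
  qed
  have p: "p 0 \<in> Hom C P A" "p 1 \<in> Hom C P D" "p 2 = f \<cdot> p 0" "p 2 = g \<cdot> p 1"
    using lim cone unfolding is_limit_def by blast+
  have "is_pullback C f g P (p 0) (p 1)"
    unfolding is_pullback_def HomD[OF f] HomD[OF g]
  proof (intro conjI allI ballI impI)
    show "f \<cdot> p 0 = g \<cdot> p 1"
      using p by simp
    fix X x y
    assume x: "x \<in> Hom C X A" and y: "y \<in> Hom C X D" and xy: "f \<cdot> x = g \<cdot> y"
    define z where "z j = (if j = 0 then x else if j = 1 then y else f \<cdot> x)" for j :: nat
    have "is_cone ?J C Fo Fa X z"
      unfolding cone using x y xy by (simp add: z_def)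
    then have "\<exists>!h. h \<in> Hom C X P \<and> (\<forall>j\<in>Obj ?J. p j \<cdot> h = z j)"
      using lim unfolding is_limit_def by blast
    \<comment> \<open>The condition at \<open>2\<close> follows from the one at \<open>0\<close>,
      because \<open>p 2 = f \<cdot> p 0\<close> and \<open>z 2 = f \<cdot> x\<close>.\<close>
    moreover have "(\<forall>j\<in>Obj ?J. p j \<cdot> h = z j) \<longleftrightarrow> p 0 \<cdot> h = x \<and> p 1 \<cdot> h = y"
      if "h \<in> Hom C X P" for h
      using Comp_assoc[OF that p(1) f] p(3) by (auto simp: cospan_shape_def z_def)
    ultimately show "\<exists>!h. h \<in> Hom C X P \<and> p 0 \<cdot> h = x \<and> p 1 \<cdot> h = y"
      by (auto cong: conj_cong)
  qed (use p HomD[OF f] HomD[OF g] in simp_all)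
  then show ?thesis by blast
qed

end

context regular_category
begin

text \<open>Think of \<open>g\<close> as a generalized element of \<open>I\<close>: it lifts along
  \<open>q\<close> once its domain is covered by a regular epimorphism \<open>e\<close>, the
  pullback of \<open>q\<close> along \<open>g\<close>.\<close>

lemma regular_epi_lift:
  assumes q: "regular_epi C q" "q \<in> Hom C A I" and g: "g \<in> Hom C X I"
  shows "\<exists>P a e. a \<in> Hom C P A \<and> regular_epi C e \<and> e \<in> Hom C P X \<and> q \<cdot> a = g \<cdot> e"
proof -
  obtain P a e where pb: "is_pullback C q g P a e"
    using pullback_exists[OF finitely_complete q(2) g] by blast
  then show ?thesis
    using pullbackD(1-3)[OF pb q(2) g] regular_epi_pullback_stable[OF q(1) pb] by blast
qed

lemma regular_epi_mono_factorization:
  assumes f: "f \<in> Hom C A B"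
  shows "\<exists>I q m. q \<in> Hom C A I \<and> regular_epi C q \<and> m \<in> Hom C I B \<and> monomorphism C m \<and> f = m \<cdot> q"
proof -
  obtain P p1 p2 where ker: "is_pullback C f f P p1 p2"
    using pullback_exists[OF finitely_complete f f] by blast
  note P = pullbackD[OF ker f f]
  obtain q where coeq: "is_coequalizer C p1 p2 q"
    using kernel_pair_has_coequalizer ker unfolding is_kernel_pair_def by blast
  define I where "I = Cod C q"
  have q: "q \<in> Hom C A I"
    using coeq HomD[OF P(1)] by (auto simp: is_coequalizer_def Hom_def I_def)
  have reg: "regular_epi C q"
    using coeq by (auto simp: regular_epi_def)
  \<comment> \<open>By the kernel pair square, \<open>f\<close> itself coequalizes \<open>p1\<close>
    and \<open>p2\<close>.\<close>
  obtain m where m: "m \<in> Hom C I B" "m \<cdot> q = f"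
    using coequalizerD(4)[OF coeq q f P(3)] by blast
  have "g = h" if g: "g \<in> Hom C X I" and h: "h \<in> Hom C X I" and eq: "m \<cdot> g = m \<cdot> h" for X g h
  proof -
    obtain Y a e where a: "a \<in> Hom C Y A" and e: "regular_epi C e" "e \<in> Hom C Y X"
      and ae: "q \<cdot> a = g \<cdot> e"
      using regular_epi_lift[OF reg q g] by blast
    note he = Comp_in_Hom[OF e(2) h]
    note ge = Comp_in_Hom[OF e(2) g]
    \<comment> \<open>Lifting \<open>h \<cdot> e\<close> instead of \<open>h\<close> puts both
      lifts, \<open>a \<cdot> d\<close> and \<open>b\<close>, over the same object
      \<open>Z\<close>.\<close>
    obtain Z b d where b: "b \<in> Hom C Z A" and d: "regular_epi C d" "d \<in> Hom C Z Y"
      and bd: "q \<cdot> b = (h \<cdot> e) \<cdot> d"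
      using regular_epi_lift[OF reg q he] by blast
    note ad = Comp_in_Hom[OF d(2) a]
    have qad: "q \<cdot> (a \<cdot> d) = (g \<cdot> e) \<cdot> d"
      using Comp_assoc[OF d(2) a q] ae by simp
    have "m \<cdot> (g \<cdot> e) = m \<cdot> (h \<cdot> e)"
      using Comp_assoc[OF e(2) g m(1)] Comp_assoc[OF e(2) h m(1)] eq by simp
    then have "m \<cdot> ((g \<cdot> e) \<cdot> d) = m \<cdot> ((h \<cdot> e) \<cdot> d)"
      using Comp_assoc[OF d(2) ge m(1)] Comp_assoc[OF d(2) he m(1)] by simp
    then have "f \<cdot> (a \<cdot> d) = f \<cdot> b"
      using Comp_assoc[OF ad q m(1)] Comp_assoc[OF b q m(1)] m(2) qad bd by simp
    then obtain k where k: "k \<in> Hom C Z P" "p1 \<cdot> k = a \<cdot> d" "p2 \<cdot> k = b"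
      using P(4)[OF ad b] by blast
    \<comment> \<open>The two sides are \<open>q \<cdot> (p1 \<cdot> k)\<close> and
      \<open>q \<cdot> (p2 \<cdot> k)\<close>, which agree because \<open>q\<close> coequalizes the
      kernel pair. The covers \<open>d\<close> and \<open>e\<close> are then cancelled in
      turn.\<close>
    have "(g \<cdot> e) \<cdot> d = (h \<cdot> e) \<cdot> d"
      using Comp_assoc[OF k(1) P(1) q] Comp_assoc[OF k(1) P(2) q] coequalizerD(3)[OF coeq q]
        k(2,3) qad bd by simp
    then have "g \<cdot> e = h \<cdot> e"
      by (rule regular_epi_cancel[OF d ge he])
    then show "g = h"
      by (rule regular_epi_cancel[OF e g h])
  qed
  then have "monomorphism C m"
    unfolding monomorphism_def using HomD[OF m(1)] by auto
  with q reg m show ?thesis by blast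
qed

end

theorem theorem1p11:
  fixes C :: "('o, 'a) cat" (structure)
  assumes "regular_category C"
  shows
    "(\<forall>A B f. f \<in> Hom C A B \<longrightarrow>
        (\<exists>I q m. q \<in> Hom C A I \<and> regular_epi C q \<and>
                 m \<in> Hom C I B \<and> monomorphism C m \<and> f = m \<cdot> q)) \<and>
     (\<forall>A B I I' f q m q' m'.
        f \<in> Hom C A B \<and>
        q \<in> Hom C A I \<and> regular_epi C q \<and> m \<in> Hom C I B \<and> monomorphism C m \<and> f = m \<cdot> q \<and>
        q' \<in> Hom C A I' \<and> regular_epi C q' \<and> m' \<in> Hom C I' B \<and> monomorphism C m' \<and> f = m' \<cdot> q'
        \<longrightarrow> (\<exists>\<theta>\<in>Hom C I I'. isomorphism C \<theta> \<and> \<theta> \<cdot> q = q' \<and> m' \<cdot> \<theta> = m))"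
proof -
  interpret regular_category C by (rule assms)
  show ?thesis
  proof (intro conjI allI impI; (elim conjE)?)
    show "\<exists>I q m. q \<in> Hom C A I \<and> regular_epi C q \<and> m \<in> Hom C I B \<and> monomorphism C m \<and> f = m \<cdot> q"
      if "f \<in> Hom C A B" for A B f
      using regular_epi_mono_factorization[OF that] .
    show "\<exists>\<theta>\<in>Hom C I I'. isomorphism C \<theta> \<and> \<theta> \<cdot> q = q' \<and> m' \<cdot> \<theta> = m"
      if "q \<in> Hom C A I" "regular_epi C q" "m \<in> Hom C I B" "monomorphism C m" "f = m \<cdot> q"
        "q' \<in> Hom C A I'" "regular_epi C q'" "m' \<in> Hom C I' B" "monomorphism C m'" "f = m' \<cdot> q'"
      for A B I I' f q m q' m'
      using that by (intro regular_epi_mono_factorization_unique) simp_all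
  qed
qed

end
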